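(* Let $P_n$ be the multiple orthogonal polynomials with the Meijer $G$-function weights $w_0,\ldots,w_{r-1}$ with parameters $\nu_1,\ldots,\nu_r$. Then \[ \lim_{n\to\infty}(-1)^n\frac{P_n(z/n)}{\prod_{j=1}^r(\nu_j+1)_n}={}_0F_r(-;\nu_1+1,\ldots,\nu_r+1;-z), \] uniformly on compact subsets of $\mathbb{C}$.
   Context: Notation: $(a)_k=a(a+1)\cdots(a+k-1)$, $(a)_0=1$, is the Pochhammer symbol; ${}_0F_r(-;b_1,\ldots,b_r;x)=\sum_{k=0}^\infty\frac{x^k}{(b_1)_k\cdots(b_r)_k\,k!}$ and ${}_1F_r(a;b_1,\ldots,b_r;x)=\sum_{k=0}^\infty\frac{(a)_k\,x^k}{(b_1)_k\cdots(b_r)_k\,k!}$ are hypergeometric functions. For $0\le j\le r-1$ the weight $w_j$ on $(0,\infty)$ is the Meijer $G$-function \[ w_j(x)=G^{r,0}_{0,r}\left(\left.\begin{array}{c}-\\ \nu_r,\nu_{r-1},\ldots,\nu_2,\nu_1+j\end{array}\right|x\right)=\frac{1}{2\pi i}\int_{c-i\infty}^{c+i\infty}(s+\nu_1)_j\prod_{k=1}^r\Gamma(s+\nu_k)\,x^{-s}\,ds, \] where $c$ is the abscissa of the vertical contour in the integral representation of the Meijer $G$-function. The polynomial $P_m$ has degree $m$ and satisfies \[ \int_0^\infty P_m(x)\,x^kw_j(x)\,dx=0,\qquad 0\le k\le\left\lceil\frac{m-j}{r}\right\rceil-1,\quad 0\le j\le r-1. \] These are multiple orthogonal polynomials with multi-index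 $(n+1,\ldots,n+1,n,\ldots,n)$ when $m=nr+s$ (with $0\le s<r$ and $n+1$ occurring $s$ times). An explicit expression for them, in the normalization used, is \[ P_n(x)=(-1)^n\prod_{j=1}^r(\nu_j+1)_n\;{}_1F_r(-n;\nu_1+1,\ldots,\nu_r+1;x). \] *)

theory Defs
  imports "HOL-Analysis.Analysis" "HOL-Computational_Algebra.Polynomial"
begin

text \<open>
  The Meijer function \<open>G\<^sup>r\<^sup>,\<^sup>0\<^sub>0\<^sub>,\<^sub>r\<close> with lower parameters \<open>b 1, \<dots>, b r\<close>, as a Mellin--Barnes
  integral over the vertical line \<open>s = c + i y\<close>; since \<open>ds = i dy\<close>, the prefactor \<open>1 / (2 \<pi> i)\<close>
  becomes \<open>1 / (2 \<pi>)\<close>.  It is symmetric in its lower parameters.  It is only meaningful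
  for \<open>x > 0\<close> and \<open>c > - b k\<close> for all \<open>k\<close>, i.e. with all poles of the integrand to the left of the
  contour; the integral then converges absolutely for \<open>r \<ge> 1\<close> and does not depend on \<open>c\<close>.
\<close>
definition meijer_G :: "real \<Rightarrow> nat \<Rightarrow> (nat \<Rightarrow> real) \<Rightarrow> real \<Rightarrow> complex" where
  "meijer_G c r b x =
     1 / (2 * of_real pi) *
     (LBINT y. (\<Prod>k=1..r. Gamma (Complex c y + of_real (b k))) * of_real x powr (- Complex c y))"

definition meijer_weight :: "real \<Rightarrow> nat \<Rightarrow> (nat \<Rightarrow> real) \<Rightarrow> nat \<Rightarrow> real \<Rightarrow> complex" where
  "meijer_weight c r \<nu> j = meijer_G c r (\<nu>(1 := \<nu> 1 + real j))"

lemma meijer_weight_altdef: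
  assumes "r \<ge> 1" and "c > - \<nu> 1"
  shows "meijer_weight c r \<nu> j x =
     1 / (2 * of_real pi) *
     (LBINT y. pochhammer (Complex c y + of_real (\<nu> 1)) j *
        (\<Prod>k=1..r. Gamma (Complex c y + of_real (\<nu> k))) * of_real x powr (- Complex c y))"
proof -
  have "(\<Prod>k=1..r. Gamma (Complex c y + of_real ((\<nu>(1 := \<nu> 1 + real j)) k))) =
        pochhammer (Complex c y + of_real (\<nu> 1)) j *
        (\<Prod>k=1..r. Gamma (Complex c y + of_real (\<nu> k)))" for y
  proof -
    let ?z = "Complex c y + of_real (\<nu> 1)"
    have nz: "?z \<notin> \<int>\<^sub>\<le>\<^sub>0"
    proof
      assume "?z \<in> \<int>\<^sub>\<le>\<^sub>0"
      then obtain n where "?z = - of_nat n" by (auto elim: nonpos_Ints_cases')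
      then have "Re ?z = - real n" by simp
      with assms(2) show False by simp
    qed
    then have shift: "Gamma (?z + of_nat j) = pochhammer ?z j * Gamma ?z"
      by (simp add: pochhammer_Gamma Gamma_eq_zero_iff)
    have split: "{1..r} = insert 1 {2..r}" using assms(1) by auto
    have "(\<Prod>k=2..r. Gamma (Complex c y + of_real ((\<nu>(1 := \<nu> 1 + real j)) k))) =
          (\<Prod>k=2..r. Gamma (Complex c y + of_real (\<nu> k)))"
      by (intro prod.cong) auto
    then show ?thesis
      unfolding split using shift by (simp add: add.assoc)
  qed
  then show ?thesis
    by (simp add: meijer_weight_def meijer_G_def mult.assoc)
qed

text \<open>
  The multiple orthogonal polynomial of degree \<open>m\<close> for the weights \<open>w\<^sub>0, \<dots>, w\<^sub>r\<^sub>-\<^sub>1\<close> on \<open>(0, \<infinity>)\<close>,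
  normalized to be monic: this is the normalization
  \<open>(-1)\<^sup>m \<cdot> (\<nu>\<^sub>1 + 1)\<^sub>m \<cdots> (\<nu>\<^sub>r + 1)\<^sub>m \<cdot> \<^sub>1F\<^sub>r(-m; \<nu>\<^sub>1 + 1, \<dots>, \<nu>\<^sub>r + 1; x)\<close>, in which the coefficient
  of \<open>x\<^sup>m\<close> is \<open>(-1)\<^sup>m \<cdot> (-m)\<^sub>m / m! = 1\<close>.  The ceiling is taken in the integers,
  so that there is no condition for \<open>w\<^sub>j\<close> if \<open>m \<le> j\<close>.
\<close>
definition meijer_multiple_orthogonal ::
    "real \<Rightarrow> nat \<Rightarrow> (nat \<Rightarrow> real) \<Rightarrow> nat \<Rightarrow> complex poly \<Rightarrow> bool" where
  "meijer_multiple_orthogonal c r \<nu> m p \<longleftrightarrow>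
     degree p = m \<and> lead_coeff p = 1 \<and>
     (\<forall>j k. j \<le> r - 1 \<and> int k \<le> \<lceil>(real m - real j) / real r\<rceil> - 1 \<longrightarrow>
        (LBINT x:{0<..}. poly p (of_real x) * of_real x ^ k * meijer_weight c r \<nu> j x) = 0)"

definition hypergeo_0F :: "nat \<Rightarrow> (nat \<Rightarrow> complex) \<Rightarrow> complex \<Rightarrow> complex" where
  "hypergeo_0F r b x = (\<Sum>k. x ^ k / ((\<Prod>j=1..r. pochhammer (b j) k) * fact k))"

end

theory Submission
  imports Defs "HOL-Probability.Levy"
begin

text \<open>
  The weight \<open>w\<^sub>j\<close> is an inverse Mellin transform of a product of Gamma factors, so it should have the
  moments \<open>\<integral> x\<^sup>m w\<^sub>j(x) dx = (m + 1 + \<nu>\<^sub>1)\<^sub>j \<Prod>\<^sub>k \<Gamma>(m + 1 + \<nu>\<^sub>k)\<close>.  For one factor this is Levy's inversion formula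
  for the logarithm of a Gamma variable; each further factor \<open>\<Gamma>(s + b)\<close> turns the inverse
  transform into its multiplicative convolution with \<open>t\<^sup>b e\<^sup>-\<^sup>t\<close>, which multiplies the moments by
  \<open>\<Gamma>(s + b)\<close>.

  Put \<open>C\<^sub>l = a\<^sub>l \<Prod>\<^sub>k \<Gamma>(l + 1 + \<nu>\<^sub>k)\<close> for the coefficients \<open>a\<^sub>l\<close> of \<open>P\<^sub>m\<close>.  The condition with indices
  \<open>(j, k)\<close> says \<open>\<Sum>\<^sub>l C\<^sub>l q(l) = 0\<close> for a polynomial \<open>q\<close> of degree \<open>r k + j\<close>, and the range of \<open>(j, k)\<close>
  makes \<open>r k + j\<close> run once through \<open>0, \<dots>, m - 1\<close>.  So \<open>C\<close> annihilates all polynomials of degree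
  below \<open>m\<close>, which forces \<open>C\<^sub>l = (-1)\<^sup>m\<^sup>-\<^sup>l (m choose l) C\<^sub>m\<close> and gives \<open>P\<^sub>m\<close> explicitly.  The limit is then
  Tannery's theorem, applied to a majorant of the error that does not depend on \<open>z \<in> K\<close>.
\<close>


subsection \<open>The Gamma function on vertical lines\<close>

lemma Complex_shift_of_real: "Complex c y + of_real b = Complex (c + b) y"
  by (simp add: complex_eq_iff)

lemma norm_powr_Complex: "t > 0 \<Longrightarrow> norm (complex_of_real t powr z) = t powr Re z"
  by (simp add: norm_powr_real_powr)

text \<open>On the real axis \<open>Ln\<close> is \<open>ln \<bar>x\<bar>\<close>, plus
  \<open>\<i> * pi\<close> on the negative half, so a real base reduces measurability to real
  logarithms and a case distinction.\<close>

lemma borel_measurable_of_real_powr [measurable]: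
  fixes f :: "'a \<Rightarrow> real" and g :: "'a \<Rightarrow> complex"
  assumes [measurable]: "f \<in> borel_measurable M" "g \<in> borel_measurable M"
  shows "(\<lambda>x. of_real (f x) powr g x) \<in> borel_measurable M"
proof -
  have eq: "of_real (f x) powr g x = (if f x = 0 then 0 else
      exp (g x * (of_real (ln \<bar>f x\<bar>) + (if f x < 0 then of_real pi else 0) * \<i>)))" for x
    using Ln_of_real'[of "f x"] by (cases "f x < 0") (auto simp: powr_def)
  show ?thesis unfolding eq by measurable
qed

lemma borel_measurable_Complex [measurable]:
  assumes [measurable]: "f \<in> borel_measurable M" "g \<in> borel_measurable M"
  shows "(\<lambda>x. Complex (f x) (g x)) \<in> borel_measurable M"
  unfolding Complex_eq by measurable

text \<open>Euler's integral, moved from the gauge integral to the Lebesgue integral over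
  \<open>lborel\<close>, the setting of Fubini's theorem and of densities.\<close>

lemma has_bochner_integral_Gamma:
  assumes "Re z > 0"
  shows "has_bochner_integral lborel
    (\<lambda>t. indicator {0<..} t *\<^sub>R (of_real t powr (z - 1) * of_real (exp (- t)))) (Gamma z)"
proof -
  let ?f = "\<lambda>t. complex_of_real t powr (z - 1) * of_real (exp (- t))"
  have eq: "complex_of_real t powr (z - 1) / of_real (exp t) = ?f t" for t
    by (simp add: exp_minus field_simps)
  have abs: "?f absolutely_integrable_on {0<..}"
    using absolutely_integrable_Gamma_integral'[OF assms] by (simp only: eq)
  have [measurable]: "(\<lambda>t. indicator {0<..} t *\<^sub>R ?f t) \<in> borel_measurable lborel"
    by measurable
  have int: "integrable lborel (\<lambda>t. indicator {0<..} t *\<^sub>R ?f t)"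
    using abs unfolding set_integrable_def by (subst (asm) integrable_completion) auto
  have "(LBINT t. indicator {0<..} t *\<^sub>R ?f t) = integral {0<..} ?f"
    using set_borel_integral_eq_integral(2)[of "{0<..}" ?f] int
    by (simp add: set_integrable_def set_lebesgue_integral_def)
  also have "\<dots> = Gamma z"
    using Gamma_integral_complex'[OF assms] by (simp only: eq integral_unique)
  finally show ?thesis using int by (simp add: has_bochner_integral_iff)
qed

lemma has_bochner_integral_Gamma_real:
  fixes s :: real
  assumes "s > 0"
  shows "has_bochner_integral lborel
    (\<lambda>t. indicator {0<..} t * (t powr (s - 1) * exp (- t))) (Gamma s)"
proof -
  have "has_bochner_integral lborel
    (\<lambda>t. Re (indicator {0<..} t *\<^sub>R (of_real t powr (of_real s - 1) * of_real (exp (- t))))) (Re (Gamma (of_real s)))"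
    by (intro has_bochner_integral_Re has_bochner_integral_Gamma) (simp add: assms)
  moreover have "Re (indicator {0<..} t *\<^sub>R (of_real t powr (of_real s - 1) * of_real (exp (- t))))
    = indicator {0<..} t * (t powr (s - 1) * exp (- t))" for t
    using powr_of_real[of t "s - 1"] by (cases "t > 0") auto
  ultimately show ?thesis by (simp only: Gamma_complex_of_real Re_complex_of_real)
qed

text \<open>For \<open>t > 0\<close> the modulus of \<open>t powr (z - 1)\<close> depends only on
  \<open>Re z\<close>, so the triangle inequality in Euler's integral suffices.\<close>

lemma norm_Gamma_le:
  assumes "Re z > 0"
  shows "norm (Gamma z :: complex) \<le> Gamma (Re z)"
proof -
  have "Gamma z = (LBINT t. indicator {0<..} t *\<^sub>R (of_real t powr (z - 1) * of_real (exp (- t))))"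
    using has_bochner_integral_Gamma[OF assms] by (simp add: has_bochner_integral_iff)
  also have "norm \<dots> \<le> (LBINT t. norm (indicator {0<..} t *\<^sub>R (complex_of_real t powr (z - 1) * of_real (exp (- t)))))"
    by (rule integral_norm_bound)
  also have "\<dots> = (LBINT t. indicator {0<..} t * (t powr (Re z - 1) * exp (- t)))"
    by (intro Bochner_Integration.integral_cong) (auto simp: indicator_def norm_mult norm_powr_Complex)
  also have "\<dots> = Gamma (Re z)"
    using has_bochner_integral_Gamma_real[OF assms] by (simp add: has_bochner_integral_iff)
  finally show ?thesis .
qed

lemma Gamma_plus_of_nat:
  fixes z :: real
  assumes "z > 0"
  shows "Gamma (z + of_nat n) = pochhammer z n * Gamma z"
proof -
  have "z \<notin> \<int>\<^sub>\<le>\<^sub>0" using assms by (auto elim!: nonpos_Ints_cases)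
  then show ?thesis
    using pochhammer_Gamma[of z n] Gamma_real_pos[OF assms] by (metis less_irrefl nonzero_eq_divide_eq)
qed

lemma continuous_on_Gamma_line:
  assumes "a > 0"
  shows "continuous_on UNIV (\<lambda>y. Gamma (Complex a y))"
proof -
  have "Complex a y \<notin> \<int>\<^sub>\<le>\<^sub>0" for y
    using assms by (auto elim!: nonpos_Ints_cases simp: complex_eq_iff)
  then show ?thesis
    unfolding Complex_eq by (intro continuous_at_imp_continuous_on ballI continuous_intros) simp
qed

lemma borel_measurable_Gamma_line:
  assumes "a > 0"
  shows "(\<lambda>y. Gamma (Complex a y)) \<in> borel_measurable borel"
  by (intro borel_measurable_continuous_onI continuous_on_Gamma_line assms)

lemma integrable_Gamma_line:
  assumes "a > 0"
  shows "integrable lborel (\<lambda>y. Gamma (Complex a y))"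
proof (rule Bochner_Integration.integrable_bound)
  \<comment> \<open>\<open>\<Gamma>(z) = \<Gamma>(z + 2) / (z (z + 1))\<close> already decays quadratically, without Stirling's formula\<close>
  define m where "m = min (a\<^sup>2) 1"
  have m: "m > 0" using assms by (simp add: m_def)
  show "integrable lborel (\<lambda>y. Gamma (a + 2) / m * inverse (1 + y\<^sup>2))"
    using integrable_inverse_1_plus_square by (simp add: set_integrable_def)
  show "(\<lambda>y. Gamma (Complex a y)) \<in> borel_measurable lborel"
    using borel_measurable_Gamma_line[OF assms] by simp
  have "norm (Gamma (Complex a y)) \<le> norm (Gamma (a + 2) / m * inverse (1 + y\<^sup>2))" for y
  proof -
    let ?z = "Complex a y"
    have nz: "?z \<notin> \<int>\<^sub>\<le>\<^sub>0" "?z + 1 \<notin> \<int>\<^sub>\<le>\<^sub>0"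
      using assms by (auto elim!: nonpos_Ints_cases simp: complex_eq_iff)
    have "?z + 2 = (?z + 1) + 1" by simp
    then have "Gamma (?z + 2) = (?z + 1) * (?z * Gamma ?z)"
      by (simp only: Gamma_plus1 nz not_False_eq_True)
    then have eq: "norm (Gamma (?z + 2)) = (norm (?z + 1) * norm ?z) * norm (Gamma ?z)"
      by (simp add: norm_mult mult.assoc)
    have "norm ?z * norm ?z \<le> norm (?z + 1) * norm ?z"
      using assms by (intro mult_right_mono) (auto simp: cmod_def)
    moreover have "norm ?z * norm ?z = a\<^sup>2 + y\<^sup>2" by (simp add: cmod_def)
    \<comment> \<open>The choice \<open>m = min (a\<^sup>2) 1\<close> lets the summands be compared
      one by one: \<open>m \<le> a\<^sup>2\<close> and
      \<open>m * y\<^sup>2 \<le> y\<^sup>2\<close>.\<close>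
    moreover have "m * (1 + y\<^sup>2) \<le> a\<^sup>2 + y\<^sup>2"
      using m mult_right_mono[of m 1 "y\<^sup>2"] by (simp add: distrib_left) (simp add: m_def)
    ultimately have "m * (1 + y\<^sup>2) * norm (Gamma ?z) \<le> norm (Gamma (?z + 2))"
      unfolding eq by (intro mult_right_mono) auto
    also have "\<dots> \<le> Gamma (a + 2)"
      using norm_Gamma_le[of "?z + 2"] assms by simp
    finally have "norm (Gamma ?z) \<le> Gamma (a + 2) / m * inverse (1 + y\<^sup>2)"
      using m by (simp add: field_simps add_pos_nonneg)
    then show ?thesis by (rule order_trans) (simp only: real_norm_def abs_ge_self)
  qed
  then show "AE y in lborel. norm (Gamma (Complex a y)) \<le> norm (Gamma (a + 2) / m * inverse (1 + y\<^sup>2))"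
    by simp
qed

subsection \<open>Inversion of integrable characteristic functions\<close>

text \<open>\<open>iexp\<close> has modulus one, so \<open>norm (char M t)\<close> dominates the
  integrand for all \<open>u\<close> at once.\<close>

lemma (in real_distribution) continuous_on_inverse_fourier_char:
  assumes int: "integrable lborel (char M)"
  shows "continuous_on UNIV (\<lambda>u. CLBINT t. char M t * iexp (- (t * u)))"
  unfolding continuous_on_sequentially comp_def
proof safe
  fix X and u :: real assume X: "X \<longlonglongrightarrow> u"
  show "(\<lambda>n. CLBINT t. char M t * iexp (- (t * X n))) \<longlonglongrightarrow> (CLBINT t. char M t * iexp (- (t * u)))"
  proof (rule integral_dominated_convergence[where w="\<lambda>t. norm (char M t)"])
    show "integrable lborel (\<lambda>t. norm (char M t))" using int by simp
    show "AE t in lborel. (\<lambda>n. char M t * iexp (- (t * X n))) \<longlonglongrightarrow> char M t * iexp (- (t * u))"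
      by (auto intro!: tendsto_intros X)
  qed (auto simp: norm_mult simp del: of_real_mult of_real_minus)
qed

text \<open>Integrability of \<open>char M\<close> removes the truncation in Levy's inversion
  formula, and the kernel there is itself the integral of \<open>iexp (- (t * u))\<close> over
  \<open>u\<close> from \<open>\<alpha>\<close> to \<open>\<beta>\<close>. Fubini's theorem then
  exposes the density.\<close>

lemma (in real_distribution) Levy_inversion_density:
  assumes int: "integrable lborel (char M)" and atom: "\<And>x. measure M {x} = 0" and le: "\<alpha> \<le> \<beta>"
  shows "complex_of_real (measure M {\<alpha><..\<beta>}) =
    integral {\<alpha>..\<beta>} (\<lambda>u. 1 / (2 * pi) * (CLBINT t. char M t * iexp (- (t * u))))"
proof -
  let ?F = "\<lambda>t. (iexp (- (t * \<alpha>)) - iexp (- (t * \<beta>))) / (\<i> * t)"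
  let ?h = "\<lambda>u. CLBINT t. char M t * iexp (- (t * u))"
  \<comment> \<open>The kernel is bounded by the length of the interval; at \<open>t = 0\<close>
    division by zero makes it \<open>0\<close>.\<close>
  have Fle: "norm (?F t) \<le> \<beta> - \<alpha>" for t
    using Levy_Inversion_aux2[of "- \<beta>" "- \<alpha>" t] le by (cases "t = 0") simp_all
  have bound: "norm (?F t * char M t) \<le> norm ((\<beta> - \<alpha>) * norm (char M t))" for t
    using mult_right_mono[OF Fle[of t] norm_ge_zero[of "char M t"]]
    unfolding norm_mult[of "?F t"] real_norm_def by linarith
  have dom: "integrable lborel (\<lambda>t. (\<beta> - \<alpha>) * norm (char M t))" using int by simp
  have intF: "integrable lborel (\<lambda>t. ?F t * char M t)"
    by (rule Bochner_Integration.integrable_bound[OF dom]) (use bound in auto)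
  have "(\<lambda>n::nat. CLBINT t. indicator {- real n<..<real n} t *\<^sub>R (?F t * char M t))
      \<longlonglongrightarrow> (CLBINT t. ?F t * char M t)"
  proof (rule integral_dominated_convergence[OF _ _ dom])
    show "AE t in lborel. (\<lambda>n::nat. indicator {- real n<..<real n} t *\<^sub>R (?F t * char M t)) \<longlonglongrightarrow> ?F t * char M t"
    proof (rule AE_I2)
      fix t :: real
      obtain N :: nat where "\<bar>t\<bar> < real N" using reals_Archimedean2 by blast
      then have "\<forall>\<^sub>F n in sequentially. indicator {- real n<..<real n} t *\<^sub>R (?F t * char M t) = ?F t * char M t"
        by (intro eventually_sequentiallyI[of N]) (auto simp: indicator_def)
      then show "(\<lambda>n::nat. indicator {- real n<..<real n} t *\<^sub>R (?F t * char M t)) \<longlonglongrightarrow> ?F t * char M t"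
        by (rule tendsto_eventually)
    qed
    show "AE t in lborel. norm (indicator {- real n<..<real n} t *\<^sub>R (?F t * char M t)) \<le> (\<beta> - \<alpha>) * norm (char M t)" for n :: nat
      using bound le by (auto simp: indicator_def)
  qed auto
  then have "(\<lambda>n::nat. 1 / (2 * pi) * (CLBINT t=-n..n. ?F t * char M t))
      \<longlonglongrightarrow> 1 / (2 * pi) * (CLBINT t. ?F t * char M t)"
    by (intro tendsto_mult tendsto_const)
      (simp add: interval_lebesgue_integral_def set_lebesgue_integral_def)
  moreover have "(\<lambda>n::nat. 1 / (2 * pi) * (CLBINT t=-n..n. ?F t * char M t)) \<longlonglongrightarrow> measure M {\<alpha><..\<beta>}"
    by (rule Levy_Inversion[OF le atom atom])
  ultimately have "complex_of_real (measure M {\<alpha><..\<beta>}) = 1 / (2 * pi) * (CLBINT t. ?F t * char M t)"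
    by (rule LIMSEQ_unique[rotated])
  also have "(CLBINT t. ?F t * char M t) =
    (CLBINT t. (CLBINT u. indicator {\<alpha>..\<beta>} u *\<^sub>R (char M t * iexp (- (t * u)))))"
  proof (rule integral_cong_AE)
    \<comment> \<open>The antiderivative in \<open>u\<close> has \<open>t\<close> in its
      denominator; the excluded point \<open>t = 0\<close> is a null set.\<close>
    have "?F t * char M t = (CLBINT u. indicator {\<alpha>..\<beta>} u *\<^sub>R (char M t * iexp (- (t * u))))" if "t \<noteq> 0" for t
    proof -
      have 1: "((\<lambda>u. char M t * iexp (- (t * u))) has_integral
          (char M t * (- iexp (- (t * \<beta>)) / (\<i> * t)) - char M t * (- iexp (- (t * \<alpha>)) / (\<i> * t)))) {\<alpha>..\<beta>}"
        using le
      proof (rule fundamental_theorem_of_calculus)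
        fix u :: real
        have "((\<lambda>w. char M t * (- exp (\<i> * (- (of_real t * w))) / (\<i> * of_real t)))
            has_field_derivative (char M t * exp (\<i> * (- (of_real t * of_real u))))) (at (of_real u))"
          using that by (auto intro!: derivative_eq_intros simp: mult_ac)
        from has_vector_derivative_real_field[OF this]
        show "((\<lambda>u. char M t * (- iexp (- (t * u)) / (\<i> * t)))
            has_vector_derivative char M t * iexp (- (t * u))) (at u within {\<alpha>..\<beta>})"
          by simp
      qed
      have 2: "set_integrable lborel {\<alpha>..\<beta>} (\<lambda>u. char M t * iexp (- (t * u)))"
        by (intro borel_integrable_atLeastAtMost' continuous_intros)
      have "(CLBINT u. indicator {\<alpha>..\<beta>} u *\<^sub>R (char M t * iexp (- (t * u)))) =
          char M t * (- iexp (- (t * \<beta>)) / (\<i> * t)) - char M t * (- iexp (- (t * \<alpha>)) / (\<i> * t))"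
        using set_borel_integral_eq_integral(2)[OF 2] integral_unique[OF 1]
        unfolding set_lebesgue_integral_def by (rule trans)
      then show ?thesis using that by (simp add: field_simps)
    qed
    then show "AE t in lborel. ?F t * char M t = (CLBINT u. indicator {\<alpha>..\<beta>} u *\<^sub>R (char M t * iexp (- (t * u))))"
      using AE_lborel_singleton[of "0::real"] by (auto elim!: eventually_mono)
  qed auto
  also have "\<dots> = (CLBINT u. (CLBINT t. indicator {\<alpha>..\<beta>} u *\<^sub>R (char M t * iexp (- (t * u)))))"
  proof (rule lborel_pair.Fubini_integral)
    show "integrable (lborel \<Otimes>\<^sub>M lborel) (\<lambda>(u, t). indicator {\<alpha>..\<beta>} u *\<^sub>R (char M t * iexp (- (t * u))))"
    proof (rule lborel_pair.Fubini_integrable)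
      have eq: "(LBINT t. norm (indicator {\<alpha>..\<beta>} u *\<^sub>R (char M t * iexp (- (t * u))))) =
          indicator {\<alpha>..\<beta>} u * (LBINT t. norm (char M t))" for u
        by (simp add: norm_mult indicator_def)
      have "integrable lborel (\<lambda>u. indicator {\<alpha>..\<beta>} u * (LBINT t. norm (char M t)))"
        by (intro integrable_mult_left integrable_real_indicator) (use le in auto)
      then show "integrable lborel (\<lambda>u. LBINT t. norm (case (u, t) of (u, t) \<Rightarrow>
          indicator {\<alpha>..\<beta>} u *\<^sub>R (char M t * iexp (- (t * u)))))"
        by (simp only: prod.case eq)
      have "integrable lborel (\<lambda>t. indicator {\<alpha>..\<beta>} u *\<^sub>R (char M t * iexp (- (t * u))))" for u
        by (rule Bochner_Integration.integrable_bound[OF int]) (auto simp: norm_mult indicator_def)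
      then show "AE u in lborel. integrable lborel (\<lambda>t. case (u, t) of (u, t) \<Rightarrow>
          indicator {\<alpha>..\<beta>} u *\<^sub>R (char M t * iexp (- (t * u))))"
        by (simp only: prod.case AE_I2)
    qed measurable
  qed
  also have "\<dots> = (CLBINT u:{\<alpha>..\<beta>}. ?h u)"
    by (simp add: set_lebesgue_integral_def)
  also have "\<dots> = integral {\<alpha>..\<beta>} ?h"
    by (intro set_borel_integral_eq_integral borel_integrable_atLeastAtMost'
      continuous_on_subset[OF continuous_on_inverse_fourier_char[OF int]]) auto
  finally show ?thesis by simp
qed

text \<open>Both sides are derivatives at \<open>u\<close> of
  \<open>measure M {\<alpha><..\<beta>}\<close> in \<open>\<beta>\<close>: one by hypothesis, the
  other by the fundamental theorem of calculus for the continuous inverse transform. This gives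
  equality at the point \<open>u\<close> itself, not just almost everywhere.\<close>

lemma (in real_distribution) Levy_inversion_derivative:
  assumes int: "integrable lborel (char M)" and atom: "\<And>x. measure M {x} = 0"
    and der: "((\<lambda>\<beta>. measure M {\<alpha><..\<beta>}) has_real_derivative D) (at u)" and "\<alpha> < u"
  shows "1 / (2 * pi) * (CLBINT t. char M t * iexp (- (t * u))) = of_real D"
proof (rule vector_derivative_unique_at)
  let ?h = "\<lambda>u. 1 / (2 * pi) * (CLBINT t. char M t * iexp (- (t * u)))"
  have "continuous_on {\<alpha>..u + 1} ?h"
    by (intro continuous_intros continuous_on_subset[OF continuous_on_inverse_fourier_char[OF int]]) auto
  then have "((\<lambda>\<beta>. integral {\<alpha>..\<beta>} ?h) has_vector_derivative ?h u) (at u within {\<alpha>..u + 1})"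
    by (rule integral_has_vector_derivative) (use \<open>\<alpha> < u\<close> in auto)
  then have "((\<lambda>\<beta>. integral {\<alpha>..\<beta>} ?h) has_vector_derivative ?h u) (at u)"
    using \<open>\<alpha> < u\<close> by (simp add: at_within_Icc_at)
  moreover have "\<forall>\<^sub>F \<beta> in nhds u. integral {\<alpha>..\<beta>} ?h = of_real (measure M {\<alpha><..\<beta>})"
    using eventually_nhds_in_open[of "{\<alpha><..}" u] \<open>\<alpha> < u\<close>
    by (auto elim!: eventually_mono simp: Levy_inversion_density[OF int atom])
  ultimately show "((\<lambda>\<beta>. complex_of_real (measure M {\<alpha><..\<beta>})) has_vector_derivative ?h u) (at u)"
    by (subst (asm) has_vector_derivative_cong_ev[where g = "\<lambda>\<beta>. complex_of_real (measure M {\<alpha><..\<beta>})"])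
      (auto dest: eventually_nhds_x_imp_x elim: eventually_mono)
  show "((\<lambda>\<beta>. complex_of_real (measure M {\<alpha><..\<beta>})) has_vector_derivative of_real D) (at u)"
    using der by (intro has_vector_derivative_of_real) (simp add: has_real_derivative_iff_has_vector_derivative)
qed

subsection \<open>Mellin inversion for the Gamma function\<close>

lemma Gamma_mellin_inversion:
  assumes a: "a > 0" and x: "x > 0"
  shows "1 / (2 * pi) * (LBINT y. Gamma (Complex a y) * of_real x powr (- Complex a y)) = of_real (exp (- x))"
proof -
  \<comment> \<open>\<open>f\<close> is the density of the Gamma distribution of shape
    \<open>a\<close>. The law \<open>M\<close> of its logarithm has characteristic function
    \<open>Gamma (Complex a y) / Gamma a\<close>, because \<open>iexp (y * ln t)\<close> is
    \<open>t\<close> to the power \<open>\<i> * y\<close>.\<close>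
  define f where "f t = indicator {0<..} t * (t powr (a - 1) * exp (- t)) / Gamma a" for t
  have Ga: "Gamma a > 0" using a by simp
  have f_nonneg: "f t \<ge> 0" for t using Ga by (simp add: f_def)
  have f_pos: "f t = t powr (a - 1) * exp (- t) / Gamma a" if "t > 0" for t
    using that by (simp add: f_def)
  have [measurable]: "f \<in> borel_measurable borel" unfolding f_def by measurable
  have f_int: "has_bochner_integral lborel f 1"
    using has_bochner_integral_divide[OF has_bochner_integral_Gamma_real[OF a], of "Gamma a"] Ga
    by (simp add: f_def[abs_def])
  define M0 where "M0 = density lborel (\<lambda>t. ennreal (f t))"
  interpret M0: prob_space M0
  proof
    have "emeasure M0 (space M0) = (\<integral>\<^sup>+t. ennreal (f t) \<partial>lborel)"
      by (simp add: M0_def emeasure_density)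
    also have "\<dots> = 1"
      using f_int f_nonneg by (subst nn_integral_eq_integral) (auto simp: has_bochner_integral_iff)
    finally show "emeasure M0 (space M0) = 1" .
  qed
  have sets_M0 [measurable_cong]: "sets M0 = sets borel" by (simp add: M0_def)
  define M where "M = distr M0 borel (ln :: real \<Rightarrow> real)"
  interpret M: real_distribution M
    unfolding M_def by (rule M0.real_distribution_distr) measurable
  have char: "char M y = Gamma (Complex a y) / of_real (Gamma a)" for y
  proof -
    have "char M y = (CLINT t|M0. iexp (y * ln t))"
      by (simp add: char_def M_def integral_distr)
    also have "\<dots> = (CLBINT t. f t *\<^sub>R iexp (y * ln t))"
      unfolding M0_def by (subst integral_density) (auto simp: f_nonneg)
    also have "\<dots> = (CLBINT t. (indicator {0<..} t *\<^sub>R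
        (of_real t powr (Complex a y - 1) * of_real (exp (- t)))) / of_real (Gamma a))"
    proof (intro Bochner_Integration.integral_cong refl)
      fix t :: real
      have "of_real t powr (Complex a y - 1) = of_real (t powr (a - 1)) * iexp (y * ln t)" if "t > 0"
      proof -
        have "of_real t powr (Complex a y - 1) = exp (of_real ((a - 1) * ln t) + \<i> * of_real (y * ln t))"
          using that by (simp add: powr_def Ln_of_real Complex_eq algebra_simps)
        also have "\<dots> = of_real (t powr (a - 1)) * iexp (y * ln t)"
          using that unfolding exp_add by (simp add: powr_def flip: exp_of_real)
        finally show ?thesis .
      qed
      then show "f t *\<^sub>R iexp (y * ln t) = (indicator {0<..} t *\<^sub>R
        (of_real t powr (Complex a y - 1) * of_real (exp (- t)))) / of_real (Gamma a)"
        by (cases "t > 0") (auto simp: f_def scaleR_conv_of_real)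
    qed
    also have "\<dots> = Gamma (Complex a y) / of_real (Gamma a)"
      using has_bochner_integral_divide[OF has_bochner_integral_Gamma[of "Complex a y"], of "of_real (Gamma a)"] a Ga
      by (simp add: has_bochner_integral_iff)
    finally show ?thesis .
  qed
  have int: "integrable lborel (char M)"
    using integrable_Gamma_line[OF a] by (simp add: char[abs_def])
  have meas: "measure M S = (LBINT t. f t * indicator S (ln t))" if [measurable]: "S \<in> sets borel" for S
  proof -
    have "measure M S = (LINT u|M. indicator S u)"
      using that by simp
    also have "\<dots> = (LINT t|M0. indicator S (ln t))"
      unfolding M_def by (rule integral_distr) measurable
    also have "\<dots> = (LBINT t. f t * indicator S (ln t))"
      unfolding M0_def by (subst integral_density) (auto simp: f_nonneg)
    finally show ?thesis .
  qed
  have atom: "measure M {u} = 0" for u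
  proof -
    have "AE t in lborel. f t * indicator {u} (ln t) = 0"
      using AE_lborel_singleton[of "exp u"]
    proof eventually_elim
      case (elim t)
      then show ?case by (cases "t > 0") (auto simp: indicator_def f_def)
    qed
    then have "(LBINT t. f t * indicator {u} (ln t)) = 0"
      by (rule integral_eq_zero_AE)
    then show ?thesis by (simp add: meas)
  qed
  define u where "u = ln x"
  have eu: "exp u = x" using x by (simp add: u_def)
  \<comment> \<open>For \<open>a < 1\<close> the density is unbounded near \<open>0\<close>; the
    left end \<open>exp (u - 1)\<close> keeps away from there.\<close>
  have f_cont: "continuous_on {exp (u - 1)..exp (u + 1)} f"
  proof -
    have "continuous_on {exp (u - 1)..exp (u + 1)} (\<lambda>t. t powr (a - 1) * exp (- t) / Gamma a)"
      using Ga by (intro continuous_intros) (auto simp: not_le[symmetric] dest: order_trans)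
    moreover have "f t = t powr (a - 1) * exp (- t) / Gamma a" if "t \<in> {exp (u - 1)..exp (u + 1)}" for t
      using that less_le_trans[OF exp_gt_zero, of "u - 1" t] by (intro f_pos) simp
    ultimately show ?thesis by (subst continuous_on_cong[OF refl])
  qed
  have measI: "measure M {u - 1<..\<beta>} = integral {exp (u - 1)..exp \<beta>} f" if "\<beta> \<in> {u - 1<..<u + 1}" for \<beta>
  proof -
    have "measure M {u - 1<..\<beta>} = (LBINT t. f t * indicator {u - 1<..\<beta>} (ln t))"
      by (simp add: meas)
    also have "\<dots> = (LBINT t. indicator {exp (u - 1)..exp \<beta>} t *\<^sub>R f t)"
    proof (rule integral_cong_AE)
      \<comment> \<open>An open and a closed left end differ only in the point
        \<open>exp (u - 1)\<close>.\<close>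
      show "AE t in lborel. f t * indicator {u - 1<..\<beta>} (ln t) = indicator {exp (u - 1)..exp \<beta>} t *\<^sub>R f t"
        using AE_lborel_singleton[of "exp (u - 1)"]
      proof eventually_elim
        case (elim t)
        show ?case
        proof (cases "t > 0")
          case True
          define w where "w = ln t"
          have t: "t = exp w" using True by (simp add: w_def)
          show ?thesis using elim unfolding t by (auto simp: indicator_def)
        qed (simp add: f_def)
      qed
    qed auto
    also have "\<dots> = integral {exp (u - 1)..exp \<beta>} f"
      using that unfolding set_lebesgue_integral_def[symmetric]
      by (intro set_borel_integral_eq_integral borel_integrable_atLeastAtMost' continuous_on_subset[OF f_cont]) auto
    finally show ?thesis .
  qed
  have "((\<lambda>v. integral {exp (u - 1)..v} f) has_real_derivative f x) (at x within {exp (u - 1)..exp (u + 1)})"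
    by (rule integral_has_real_derivative[OF f_cont]) (simp add: eu[symmetric])
  then have "((\<lambda>v. integral {exp (u - 1)..v} f) has_real_derivative f x) (at x)"
    by (subst (asm) at_within_Icc_at) (simp_all add: eu[symmetric])
  \<comment> \<open>The chain rule through \<open>exp\<close> contributes the factor
    \<open>x\<close>: the logarithm has density \<open>f x * x\<close> at \<open>u\<close>.\<close>
  then have "((\<lambda>\<beta>. integral {exp (u - 1)..exp \<beta>} f) has_real_derivative f x * x) (at u)"
    using DERIV_chain2[of "\<lambda>v. integral {exp (u - 1)..v} f" "f x" exp u x UNIV] DERIV_exp[of u]
    by (simp add: eu)
  moreover have "\<forall>\<^sub>F \<beta> in nhds u. integral {exp (u - 1)..exp \<beta>} f = measure M {u - 1<..\<beta>}"
    using eventually_nhds_in_open[of "{u - 1<..<u + 1}" u] by (auto elim!: eventually_mono simp: measI)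
  ultimately have "((\<lambda>\<beta>. measure M {u - 1<..\<beta>}) has_real_derivative f x * x) (at u)"
    by (subst (asm) DERIV_cong_ev[OF refl _ refl]) auto
  from M.Levy_inversion_derivative[OF int atom this]
  have "1 / (2 * pi) * (CLBINT y. char M y * iexp (- (y * u))) = of_real (f x * x)"
    by simp
  also have "f x * x = x powr a * exp (- x) / Gamma a"
    using x by (simp add: f_pos powr_diff)
  \<comment> \<open>The phase \<open>iexp (- (y * u))\<close> is the complex power of
    \<open>x\<close> times \<open>x powr a\<close>. Both sides thus carry
    \<open>x powr a / Gamma a\<close>, which is nonzero and cancels at the end.\<close>
  also have "(CLBINT y. char M y * iexp (- (y * u))) =
    (CLBINT y. of_real (x powr a / Gamma a) * (Gamma (Complex a y) * of_real x powr (- Complex a y)))"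
  proof (intro Bochner_Integration.integral_cong refl)
    fix y
    have "of_real x powr (- Complex a y) = exp (- of_real (a * u) + \<i> * of_real (- (y * u)))"
      using x by (simp add: powr_def Ln_of_real Complex_eq u_def algebra_simps)
    also have "\<dots> = iexp (- (y * u)) / of_real (x powr a)"
      using x unfolding exp_add exp_minus by (simp add: powr_def u_def divide_inverse mult.commute flip: exp_of_real)
    finally show "char M y * iexp (- (y * u)) =
      of_real (x powr a / Gamma a) * (Gamma (Complex a y) * of_real x powr (- Complex a y))"
      using x by (simp add: char)
  qed
  also have "\<dots> = of_real (x powr a / Gamma a) * (LBINT y. Gamma (Complex a y) * of_real x powr (- Complex a y))"
    by (rule integral_mult_right_zero)
  finally have "of_real (x powr a / Gamma a) *
      (1 / (2 * pi) * (LBINT y. Gamma (Complex a y) * of_real x powr (- Complex a y))) =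
      complex_of_real (x powr a / Gamma a) * of_real (exp (- x))"
    by (simp add: mult_ac)
  moreover have "x powr a / Gamma a \<noteq> 0" using x Ga by simp
  ultimately show ?thesis by (metis mult_left_cancel of_real_eq_0_iff)
qed

subsection \<open>Inverse Mellin transforms and Gamma factors\<close>

text \<open>\<open>A\<close> holds the values of the transform on the line of abscissa
  \<open>c\<close>, as a function of the ordinate, so that Gamma factors can be multiplied in one at
  a time.\<close>

definition inverse_mellin :: "real \<Rightarrow> (real \<Rightarrow> complex) \<Rightarrow> real \<Rightarrow> complex" where
  "inverse_mellin c A x = 1 / (2 * of_real pi) * (LBINT y. A y * of_real x powr (- Complex c y))"

lemma borel_measurable_inverse_mellin [measurable]:
  assumes [measurable]: "A \<in> borel_measurable borel"
  shows "inverse_mellin c A \<in> borel_measurable borel"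
  unfolding inverse_mellin_def[abs_def] by measurable

lemma has_bochner_integral_rescale:
  fixes f :: "real \<Rightarrow> 'a :: {banach, second_countable_topology}"
  assumes f: "has_bochner_integral lborel (\<lambda>x. indicator {0<..} x *\<^sub>R f x) I" and t: "t > 0"
  shows "has_bochner_integral lborel (\<lambda>x. indicator {0<..} x *\<^sub>R f (x / t)) (t *\<^sub>R I)"
proof -
  have "has_bochner_integral lborel (\<lambda>x. indicator {0<..} (0 + 1 / t * x) *\<^sub>R f (0 + 1 / t * x)) (I /\<^sub>R \<bar>1 / t\<bar>)"
    using f by (subst (asm) lborel_has_bochner_integral_real_affine_iff[of "1 / t" _ _ 0]) (use t in auto)
  then show ?thesis using t by (simp add: indicator_def zero_less_divide_iff)
qed

text \<open>Once Euler's integral replaces the Gamma factor, the powers of \<open>t\<close> and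
  \<open>x\<close> merge into a power of \<open>x / t\<close>; exchanging the integrals leaves the
  inverse transform of \<open>A\<close> at \<open>x / t\<close>.\<close>

lemma inverse_mellin_mult_Gamma:
  assumes A: "integrable lborel A" and cb: "c + b > 0" and x: "x > 0"
  shows "inverse_mellin c (\<lambda>y. A y * Gamma (Complex c y + of_real b)) x =
    (LBINT t. indicator {0<..} t *\<^sub>R (of_real (t powr (b - 1) * exp (- t)) * inverse_mellin c A (x / t)))"
proof -
  have [measurable]: "A \<in> borel_measurable borel" using borel_measurable_integrable[OF A] by simp
  define K where "K t y = indicator {0<..} t *\<^sub>R
    (of_real (t powr (b - 1) * exp (- t)) * (A y * of_real (x / t) powr (- Complex c y)))" for t y
  have [measurable]: "case_prod K \<in> borel_measurable (lborel \<Otimes>\<^sub>M lborel)"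
    unfolding K_def[abs_def] by measurable
  have K_t: "(LBINT t. K t y) = A y * Gamma (Complex c y + of_real b) * of_real x powr (- Complex c y)" for y
  proof -
    let ?z = "Complex c y + of_real b"
    have K_eq: "K t y = (A y * of_real x powr (- Complex c y)) *
        (indicator {0<..} t *\<^sub>R (of_real t powr (?z - 1) * of_real (exp (- t))))" for t
    proof (cases "t > 0")
      case True
      have "of_real (t powr (b - 1)) * of_real (x / t) powr (- Complex c y)
          = of_real x powr (- Complex c y) * of_real t powr (?z - 1)"
        using True x
        by (simp add: powr_def Ln_of_real ln_div algebra_simps del: of_real_divide flip: exp_of_real exp_add)
      then show ?thesis using True by (simp add: K_def mult_ac)
    qed (simp add: K_def)
    have "(LBINT t. K t y) = (A y * of_real x powr (- Complex c y)) *
        (LBINT t. indicator {0<..} t *\<^sub>R (of_real t powr (?z - 1) * of_real (exp (- t))))"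
      unfolding K_eq by (rule integral_mult_right_zero)
    also have "(LBINT t. indicator {0<..} t *\<^sub>R (of_real t powr (?z - 1) * of_real (exp (- t)))) = Gamma ?z"
      using has_bochner_integral_Gamma[of ?z] cb by (simp add: has_bochner_integral_iff)
    finally show ?thesis by (simp only: mult_ac)
  qed
  \<comment> \<open>Only the real part \<open>c\<close> of the exponent affects the modulus, so the
    variables separate and absolute integrability on the product space follows.\<close>
  have norm_K: "norm (K t y) = x powr (- c) * (indicator {0<..} t * (t powr (c + b - 1) * exp (- t))) * norm (A y)" for t y
  proof (cases "t > 0")
    case True
    have "norm (complex_of_real (x / t) powr (- Complex c y)) = (x / t) powr (- c)"
      using True x by (subst norm_powr_Complex) auto
    moreover have "t powr (b - 1) * (x / t) powr (- c) = x powr (- c) * t powr (c + b - 1)"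
      using True x by (simp add: powr_def ln_div algebra_simps flip: exp_add)
    ultimately show ?thesis using True by (simp add: K_def norm_mult mult_ac)
  qed (simp add: K_def)
  have intK: "integrable (lborel \<Otimes>\<^sub>M lborel) (case_prod K)"
  proof (rule lborel_pair.Fubini_integrable)
    have eq: "(LBINT y. norm (K t y)) = x powr (- c) * (LBINT y. norm (A y)) *
        (indicator {0<..} t * (t powr (c + b - 1) * exp (- t)))" for t
      unfolding norm_K by (subst integral_mult_right_zero) (simp add: mult_ac)
    show "integrable lborel (\<lambda>t. LBINT y. norm (case (t, y) of (t, y) \<Rightarrow> K t y))"
      unfolding prod.case eq
      using has_bochner_integral_Gamma_real[OF cb] by (intro integrable_mult_right) (simp add: has_bochner_integral_iff)
    have "integrable lborel (K t)" for t
    proof (rule Bochner_Integration.integrable_bound)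
      show "integrable lborel (\<lambda>y. x powr (- c) * (indicator {0<..} t * (t powr (c + b - 1) * exp (- t))) * norm (A y))"
        using A by simp
      show "K t \<in> borel_measurable lborel" unfolding K_def[abs_def] by measurable
    qed (auto simp: norm_K)
    then show "AE t in lborel. integrable lborel (\<lambda>y. case (t, y) of (t, y) \<Rightarrow> K t y)"
      by simp
  qed measurable
  have "inverse_mellin c (\<lambda>y. A y * Gamma (Complex c y + of_real b)) x =
      1 / (2 * of_real pi) * (LBINT y. (LBINT t. K t y))"
    by (simp add: inverse_mellin_def K_t)
  also have "(LBINT y. (LBINT t. K t y)) = (LBINT t. (LBINT y. K t y))"
    by (rule lborel_pair.Fubini_integral[OF intK])
  also have "1 / (2 * of_real pi) * (LBINT t. (LBINT y. K t y)) = (LBINT t. 1 / (2 * of_real pi) * (LBINT y. K t y))"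
    by (rule integral_mult_right_zero[symmetric])
  also have "\<dots> = (LBINT t. indicator {0<..} t *\<^sub>R
      (of_real (t powr (b - 1) * exp (- t)) * inverse_mellin c A (x / t)))"
  proof (intro Bochner_Integration.integral_cong refl)
    fix t
    let ?C = "complex_of_real (indicator {0<..} t * (t powr (b - 1) * exp (- t)))"
    have "(LBINT y. K t y) = (LBINT y. ?C * (A y * of_real (x / t) powr (- Complex c y)))"
      by (intro Bochner_Integration.integral_cong refl) (simp add: K_def scaleR_conv_of_real indicator_def)
    also have "\<dots> = ?C * (LBINT y. A y * of_real (x / t) powr (- Complex c y))"
      by (rule integral_mult_right_zero)
    finally show "1 / (2 * of_real pi) * (LBINT y. K t y) = indicator {0<..} t *\<^sub>R
        (of_real (t powr (b - 1) * exp (- t)) * inverse_mellin c A (x / t))"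
      by (simp add: inverse_mellin_def scaleR_conv_of_real)
  qed
  finally show ?thesis .
qed

text \<open>The Mellin transform turns multiplicative convolution into a product. Here
  \<open>c + b > 0\<close> serves the convolution formula on the contour and
  \<open>s + b > 0\<close> the moment of the kernel.\<close>

lemma has_bochner_integral_inverse_mellin_mult_Gamma:
  assumes A: "integrable lborel A" and cb: "c + b > 0" and sb: "s + b > 0"
    and I: "has_bochner_integral lborel
      (\<lambda>x. indicator {0<..} x *\<^sub>R (of_real (x powr (s - 1)) * inverse_mellin c A x)) I"
  shows "has_bochner_integral lborel
      (\<lambda>x. indicator {0<..} x *\<^sub>R (of_real (x powr (s - 1)) *
         inverse_mellin c (\<lambda>y. A y * Gamma (Complex c y + of_real b)) x)) (I * of_real (Gamma (s + b)))"
proof -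
  have [measurable]: "A \<in> borel_measurable borel" using borel_measurable_integrable[OF A] by simp
  let ?G = "inverse_mellin c A"
  let ?g = "\<lambda>t::real. indicator {0<..} t * (t powr (s + b - 1) * exp (- t))"
  have g: "has_bochner_integral lborel ?g (Gamma (s + b))"
    by (rule has_bochner_integral_Gamma_real[OF sb])
  define F where "F t x = indicator {0<..} t *\<^sub>R (indicator {0<..} x *\<^sub>R
    (of_real (t powr (b - 1) * exp (- t)) * (of_real (x powr (s - 1)) * ?G (x / t))))" for t x
  have [measurable]: "case_prod F \<in> borel_measurable (lborel \<Otimes>\<^sub>M lborel)"
    unfolding F_def[abs_def] by measurable
  \<comment> \<open>All but the kernel becomes a function of \<open>x / t\<close>; dilation by
    \<open>t\<close> multiplies its integral by \<open>t\<close>, which the divisor in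
    \<open>?g t / t\<close> absorbs.\<close>
  have F_eq: "F t x = (?g t / t) *\<^sub>R (indicator {0<..} x *\<^sub>R (of_real ((x / t) powr (s - 1)) * ?G (x / t)))" for t x
  proof (cases "t > 0 \<and> x > 0")
    case True
    then have eq: "t powr (b - 1) * x powr (s - 1) = t powr (s + b - 1) / t * (x / t) powr (s - 1)"
      by (simp add: powr_divide powr_diff powr_add field_simps)
    have "F t x = of_real ((t powr (b - 1) * x powr (s - 1)) * exp (- t)) * ?G (x / t)"
      using True by (simp add: F_def mult_ac)
    also have "\<dots> = of_real (?g t / t) * (of_real ((x / t) powr (s - 1)) * ?G (x / t))"
      unfolding eq using True by simp
    finally show ?thesis using True by (simp add: scaleR_conv_of_real)
  qed (auto simp: F_def)
  have Fx: "has_bochner_integral lborel (F t) (?g t *\<^sub>R I)" for t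
  proof (cases "t > 0")
    case True
    show ?thesis
      using has_bochner_integral_scaleR_right[OF has_bochner_integral_rescale[OF I True], of "?g t / t"] True
      by (simp add: F_eq[abs_def])
  qed (simp add: F_def[abs_def] has_bochner_integral_zero)
  have normFx: "(LBINT x. norm (F t x)) = ?g t *
      (LBINT x. norm (indicator {0<..} x *\<^sub>R (of_real (x powr (s - 1)) * ?G x)))" for t
  proof (cases "t > 0")
    case True
    let ?N = "\<lambda>x. norm (of_real (x powr (s - 1)) * ?G x)"
    have "has_bochner_integral lborel (\<lambda>x. indicator {0<..} x *\<^sub>R ?N x) (LBINT x. indicator {0<..} x *\<^sub>R ?N x)"
      using I[unfolded has_bochner_integral_iff, THEN conjunct1, THEN integrable_norm]
      by (simp add: has_bochner_integral_iff)
    from has_bochner_integral_scaleR_right[OF has_bochner_integral_rescale[OF this True], of "?g t / t"]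
    have "(LBINT x. (?g t / t) *\<^sub>R (indicator {0<..} x *\<^sub>R ?N (x / t))) =
        (?g t / t) *\<^sub>R t *\<^sub>R (LBINT x. indicator {0<..} x *\<^sub>R ?N x)"
      by (rule has_bochner_integral_integral_eq)
    moreover have "norm (F t x) = (?g t / t) *\<^sub>R (indicator {0<..} x *\<^sub>R ?N (x / t))" for x
      using True unfolding F_eq norm_scaleR by simp
    ultimately show ?thesis using True by simp
  qed (simp add: F_def)
  have intF: "integrable (lborel \<Otimes>\<^sub>M lborel) (case_prod F)"
  proof (rule lborel_pair.Fubini_integrable)
    show "integrable lborel (\<lambda>t. LBINT x. norm (case (t, x) of (t, x) \<Rightarrow> F t x))"
      unfolding prod.case normFx using g by (intro integrable_mult_left) (simp add: has_bochner_integral_iff)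
    show "AE t in lborel. integrable lborel (\<lambda>x. case (t, x) of (t, x) \<Rightarrow> F t x)"
      using Fx by (simp add: has_bochner_integral_iff)
  qed measurable
  have Ft: "(LBINT t. F t x) = indicator {0<..} x *\<^sub>R (of_real (x powr (s - 1)) *
      inverse_mellin c (\<lambda>y. A y * Gamma (Complex c y + of_real b)) x)" for x
  proof (cases "x > 0")
    case True
    have "(LBINT t. F t x) = (LBINT t. of_real (x powr (s - 1)) *
        (indicator {0<..} t *\<^sub>R (of_real (t powr (b - 1) * exp (- t)) * ?G (x / t))))"
      using True by (intro Bochner_Integration.integral_cong refl) (simp add: F_def mult_ac)
    also have "\<dots> = of_real (x powr (s - 1)) *
        (LBINT t. indicator {0<..} t *\<^sub>R (of_real (t powr (b - 1) * exp (- t)) * ?G (x / t)))"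
      by (rule integral_mult_right_zero)
    finally show ?thesis using True by (simp only: inverse_mellin_mult_Gamma[OF A cb True]) simp
  qed (simp add: F_def)
  have "(LBINT x. (LBINT t. F t x)) = (LBINT t. (LBINT x. F t x))"
    by (rule lborel_pair.Fubini_integral[OF intF])
  also have "\<dots> = (LBINT t. ?g t *\<^sub>R I)"
    using Fx by (simp add: has_bochner_integral_iff)
  also have "\<dots> = I * of_real (Gamma (s + b))"
    using has_bochner_integral_scaleR_left[OF g, of I] by (simp add: has_bochner_integral_iff scaleR_conv_of_real mult.commute)
  finally have "(LBINT x. (LBINT t. F t x)) = I * of_real (Gamma (s + b))" .
  moreover have "integrable lborel (\<lambda>x. LBINT t. F t x)"
    by (rule lborel_pair.integrable_snd[OF intF])
  ultimately show ?thesis by (simp only: has_bochner_integral_iff Ft)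
qed

subsection \<open>Moments of the weights\<close>

text \<open>Shifting the argument by \<open>b\<close> moves the contour to abscissa
  \<open>c + b\<close>, at the price of the factor \<open>x powr b\<close>.\<close>

lemma inverse_mellin_Gamma:
  assumes "c + b > 0" "x > 0"
  shows "inverse_mellin c (\<lambda>y. Gamma (Complex c y + of_real b)) x = of_real (x powr b * exp (- x))"
proof -
  have eq: "Gamma (Complex c y + of_real b) * of_real x powr (- Complex c y) =
      of_real (x powr b) * (Gamma (Complex (c + b) y) * of_real x powr (- Complex (c + b) y))" for y
  proof -
    have "of_real x powr (- Complex c y) = of_real (x powr b) * of_real x powr (- Complex (c + b) y)"
      using assms(2) unfolding Complex_shift_of_real[symmetric]
      by (simp add: powr_def Ln_of_real algebra_simps flip: exp_of_real exp_add)
    then show ?thesis by (simp add: Complex_shift_of_real)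
  qed
  have "inverse_mellin c (\<lambda>y. Gamma (Complex c y + of_real b)) x = of_real (x powr b) *
      (1 / (2 * pi) * (LBINT y. Gamma (Complex (c + b) y) * of_real x powr (- Complex (c + b) y)))"
    unfolding inverse_mellin_def eq by (subst integral_mult_right_zero) simp
  then show ?thesis
    unfolding Gamma_mellin_inversion[OF assms] by simp
qed

text \<open>One factor supplies integrability; each further one is bounded on the line by its value
  at the real point.\<close>

lemma integrable_prod_Gamma_line:
  fixes r :: nat
  assumes "r \<ge> 1" and "\<And>k. k \<in> {1..r} \<Longrightarrow> c + b k > 0"
  shows "integrable lborel (\<lambda>y. \<Prod>k=1..r. Gamma (Complex c y + of_real (b k)))"
  using assms
proof (induction r rule: dec_induct)
  case base
  then show ?case using integrable_Gamma_line[of "c + b 1"] by (simp add: Complex_shift_of_real)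
next
  case (step r)
  have pos: "c + b (Suc r) > 0" using step.prems by simp
  have int: "integrable lborel (\<lambda>y. \<Prod>k=1..r. Gamma (Complex c y + of_real (b k)))"
    using step by auto
  have "integrable lborel (\<lambda>y. (\<Prod>k=1..r. Gamma (Complex c y + of_real (b k))) * Gamma (Complex (c + b (Suc r)) y))"
  proof (rule Bochner_Integration.integrable_bound)
    show "integrable lborel (\<lambda>y. Gamma (c + b (Suc r)) *\<^sub>R (\<Prod>k=1..r. Gamma (Complex c y + of_real (b k))))"
      using int by simp
    show "(\<lambda>y. (\<Prod>k=1..r. Gamma (Complex c y + of_real (b k))) * Gamma (Complex (c + b (Suc r)) y))
        \<in> borel_measurable lborel"
      using borel_measurable_integrable[OF int] borel_measurable_Gamma_line[OF pos] by simp
    show "AE y in lborel. norm ((\<Prod>k=1..r. Gamma (Complex c y + of_real (b k))) * Gamma (Complex (c + b (Suc r)) y))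
        \<le> norm (Gamma (c + b (Suc r)) *\<^sub>R (\<Prod>k=1..r. Gamma (Complex c y + of_real (b k))))"
      using norm_Gamma_le[of "Complex (c + b (Suc r)) y" for y] pos
      by (intro AE_I2) (simp add: norm_mult mult.commute mult_right_mono)
  qed
  then show ?case by (simp add: Complex_shift_of_real)
qed

lemma meijer_G_eq_inverse_mellin:
  "meijer_G c r b = inverse_mellin c (\<lambda>y. \<Prod>k=1..r. Gamma (Complex c y + of_real (b k)))"
  by (simp add: fun_eq_iff meijer_G_def inverse_mellin_def)

text \<open>The exponent \<open>s\<close> is independent of the abscissa \<open>c\<close>: both only
  have to lie to the right of the poles, so one contour serves all moments.\<close>

lemma has_bochner_integral_meijer_G:
  assumes "r \<ge> 1" and "\<And>k. k \<in> {1..r} \<Longrightarrow> c + b k > 0" and "\<And>k. k \<in> {1..r} \<Longrightarrow> s + b k > 0"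
  shows "has_bochner_integral lborel
    (\<lambda>x. indicator {0<..} x *\<^sub>R (of_real (x powr (s - 1)) * meijer_G c r b x))
    (of_real (\<Prod>k=1..r. Gamma (s + b k)))"
  unfolding meijer_G_eq_inverse_mellin using assms
proof (induction r rule: dec_induct)
  case base
  have "has_bochner_integral lborel
      (\<lambda>x. complex_of_real (indicator {0<..} x * (x powr (s + b 1 - 1) * exp (- x)))) (of_real (Gamma (s + b 1)))"
    using base by (intro has_bochner_integral_of_real has_bochner_integral_Gamma_real) auto
  moreover have "indicator {0<..} x *\<^sub>R (of_real (x powr (s - 1)) *
      inverse_mellin c (\<lambda>y. \<Prod>k=1..1. Gamma (Complex c y + of_real (b k))) x) =
      of_real (indicator {0<..} x * (x powr (s + b 1 - 1) * exp (- x)))" for x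
    using base inverse_mellin_Gamma[of c "b 1" x]
    by (cases "x > 0") (auto simp: powr_add[symmetric] algebra_simps simp flip: of_real_mult)
  ultimately show ?case by simp
next
  case (step r)
  have "has_bochner_integral lborel (\<lambda>x. indicator {0<..} x *\<^sub>R (of_real (x powr (s - 1)) *
      inverse_mellin c (\<lambda>y. (\<Prod>k=1..r. Gamma (Complex c y + of_real (b k))) *
        Gamma (Complex c y + of_real (b (Suc r)))) x))
      (of_real (\<Prod>k=1..r. Gamma (s + b k)) * of_real (Gamma (s + b (Suc r))))"
    using step by (intro has_bochner_integral_inverse_mellin_mult_Gamma integrable_prod_Gamma_line) auto
  then show ?case by simp
qed

lemma has_bochner_integral_meijer_weight:
  assumes "r \<ge> 1" and \<nu>: "\<And>k. k \<in> {1..r} \<Longrightarrow> \<nu> k > -1" and c: "\<And>k. k \<in> {1..r} \<Longrightarrow> c > - \<nu> k"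
  shows "has_bochner_integral lborel
    (\<lambda>x. indicator {0<..} x *\<^sub>R (of_real x ^ m * meijer_weight c r \<nu> j x))
    (of_real (pochhammer (real m + 1 + \<nu> 1) j * (\<Prod>k=1..r. Gamma (real m + 1 + \<nu> k))))"
proof -
  let ?b = "\<nu>(1 := \<nu> 1 + real j)"
  have "has_bochner_integral lborel
      (\<lambda>x. indicator {0<..} x *\<^sub>R (of_real (x powr (real m + 1 - 1)) * meijer_G c r ?b x))
      (of_real (\<Prod>k=1..r. Gamma (real m + 1 + ?b k)))"
    using assms(1)
  proof (rule has_bochner_integral_meijer_G)
    fix k assume "k \<in> {1..r}"
    with \<nu>[of k] c[of k] show "c + ?b k > 0" "real m + 1 + ?b k > 0" by auto
  qed
  moreover have "indicator {0<..} x *\<^sub>R (of_real (x powr (real m + 1 - 1)) * meijer_G c r ?b x) =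
      indicator {0<..} x *\<^sub>R (of_real x ^ m * meijer_weight c r \<nu> j x)" for x
    by (cases "x > 0") (simp_all add: powr_realpow meijer_weight_def)
  moreover have "(\<Prod>k=1..r. Gamma (real m + 1 + ?b k)) =
      pochhammer (real m + 1 + \<nu> 1) j * (\<Prod>k=1..r. Gamma (real m + 1 + \<nu> k))"
  proof -
    \<comment> \<open>Only the parameter of index \<open>1\<close> is shifted, and the functional
      equation of Gamma turns that shift into the Pochhammer symbol.\<close>
    have split: "{1..r} = insert 1 {2..r}" using assms(1) by auto
    have "real m + 1 + \<nu> 1 > 0" using \<nu>[of 1] assms(1) by simp
    note Gamma_plus_of_nat[OF this, of j]
    moreover have "(\<Prod>k=2..r. Gamma (real m + 1 + ?b k)) = (\<Prod>k=2..r. Gamma (real m + 1 + \<nu> k))"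
      by (intro prod.cong) auto
    ultimately show ?thesis unfolding split by (simp add: add.assoc)
  qed
  ultimately show ?thesis by (simp only:)
qed

subsection \<open>Annihilators of polynomials of lower degree\<close>

text \<open>Having some \<open>q d\<close> of every degree below \<open>m\<close>, one strips off
  the leading terms of \<open>f\<close> one at a time without changing \<open>L\<close>.\<close>

lemma annihilator_of_lower_degree:
  fixes L :: "'a::field poly \<Rightarrow> 'b::ab_group_add" and q :: "nat \<Rightarrow> 'a poly"
  assumes q: "\<And>d. d < m \<Longrightarrow> degree (q d) = d \<and> q d \<noteq> 0"
    and diff: "\<And>f g. L (f - g) = L f - L g"
    and L: "\<And>d a. d < m \<Longrightarrow> L (smult a (q d)) = 0"
    and f: "degree f < m"
  shows "L f = 0"
proof -
  \<comment> \<open>Vanishing coefficients from \<open>n\<close> on replace a degree bound, so that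
    \<open>n = 0\<close> means the zero polynomial; there \<open>L 0 = L 0 - L 0\<close> gives
    \<open>0\<close>.\<close>
  have "L g = 0" if "n \<le> m" "\<And>i. i \<ge> n \<Longrightarrow> coeff g i = 0" for n g
    using that
  proof (induction n arbitrary: g)
    case 0
    then have "g = 0" by (simp add: poly_eq_iff)
    then show ?case using diff[of 0 0] by simp
  next
    case (Suc n)
    define h where "h = smult (coeff g n / lead_coeff (q n)) (q n)"
    have n: "n < m" using Suc.prems by simp
    have "coeff (g - h) i = 0" if "i \<ge> n" for i
      using q[OF n] leading_coeff_neq_0[of "q n"] that Suc.prems(2)[of i] by (cases "i = n") (auto simp: h_def coeff_eq_0 simp del: leading_coeff_0_iff)
    then have "L (g - h) = 0" using Suc by simp
    then show ?case using diff[of g h] L[OF n] by (simp add: h_def)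
  qed
  from this[of m f] show ?thesis using f by (simp add: coeff_eq_0)
qed

lemma prod_diff_below: "(\<Prod>l<i. of_nat i - of_nat l :: 'a::field_char_0) = fact i"
proof -
  have "(\<Prod>l<i. of_nat i - of_nat l :: 'a) = of_nat (\<Prod>l<i. i - l)"
    by (simp add: of_nat_diff)
  then show ?thesis by (simp add: fact_prod_rev atLeast0LessThan)
qed

lemma prod_diff_above:
  "(\<Prod>l\<in>{Suc i..<Suc i + n}. of_nat i - of_nat l :: 'a::field_char_0) = (-1) ^ n * fact n"
proof (induction n)
  case (Suc n)
  have "{Suc i..<Suc i + Suc n} = insert (Suc i + n) {Suc i..<Suc i + n}" by auto
  then show ?case using Suc by (simp add: algebra_simps)
qed simp

text \<open>A test polynomial vanishing at all nodes but \<open>i\<close> and \<open>m\<close> has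
  degree \<open>m - 1\<close>, just low enough, and leaves a relation between \<open>c i\<close> and
  \<open>c m\<close> alone.\<close>

lemma orthogonal_to_lower_degree_imp_binomial:
  fixes c :: "nat \<Rightarrow> 'a::field_char_0"
  assumes orth: "\<And>f. degree f < m \<Longrightarrow> (\<Sum>l\<le>m. c l * poly f (of_nat l)) = 0" and "i \<le> m"
  shows "c i = (-1) ^ (m - i) * of_nat (m choose i) * c m"
proof (cases "i = m")
  case False
  then have i: "i < m" using \<open>i \<le> m\<close> by simp
  define S where "S = {..<m} - {i}"
  define f :: "'a poly" where "f = (\<Prod>l\<in>S. [:- of_nat l, 1:])"
  have S: "finite S" "card S = m - 1" using i by (auto simp: S_def)
  have f_eval: "poly f x = (\<Prod>l\<in>S. x - of_nat l)" for x
    by (simp add: f_def poly_prod)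
  have "degree f = (\<Sum>l\<in>S. 1)" unfolding f_def by (subst degree_prod_eq_sum_degree) auto
  then have "degree f < m" using S i by simp
  from orth[OF this] have "(\<Sum>l\<le>m. c l * poly f (of_nat l)) = 0" .
  also have "(\<Sum>l\<le>m. c l * poly f (of_nat l)) = (\<Sum>l\<in>{i, m}. c l * poly f (of_nat l))"
  proof (rule sum.mono_neutral_right)
    show "\<forall>l\<in>{..m} - {i, m}. c l * poly f (of_nat l) = 0"
    proof
      fix l assume "l \<in> {..m} - {i, m}"
      then have "l \<in> S" by (auto simp: S_def)
      then show "c l * poly f (of_nat l) = 0" using S(1) by (auto simp: f_eval)
    qed
  qed (use i in auto)
  finally have rel: "c i * poly f (of_nat i) + c m * poly f (of_nat m) = 0" using i by simp
  have fi: "poly f (of_nat i) = (-1) ^ (m - 1 - i) * (fact i * fact (m - 1 - i))"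
  proof -
    have "S = {..<i} \<union> {Suc i..<Suc i + (m - 1 - i)}" using i by (auto simp: S_def)
    then have "poly f (of_nat i) = (\<Prod>l<i. of_nat i - of_nat l) * (\<Prod>l\<in>{Suc i..<Suc i + (m - 1 - i)}. of_nat i - of_nat l)"
      unfolding f_eval by (simp only:) (rule prod.union_disjoint; auto)
    then show ?thesis by (simp only: prod_diff_below prod_diff_above mult_ac)
  qed
  \<comment> \<open>Multiplying by \<open>m - i\<close> restores the omitted root \<open>i\<close>,
    which completes the product to \<open>fact m\<close>.\<close>
  have fm: "of_nat (m - i) * poly f (of_nat m) = fact m"
  proof -
    have "{..<m} = insert i S" using i by (auto simp: S_def)
    then have "(\<Prod>l<m. of_nat m - of_nat l :: 'a) = (of_nat m - of_nat i) * poly f (of_nat m)"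
      unfolding f_eval using S(1) by (simp only:) (subst prod.insert; auto simp: S_def)
    then show ?thesis using i by (simp add: prod_diff_below of_nat_diff)
  qed
  have mi: "m - i = Suc (m - 1 - i)" using i by simp
  have "fact (m - i) = of_nat (m - i) * (fact (m - 1 - i) :: 'a)" by (simp only: mi fact_Suc)
  moreover have "of_nat (m choose i) * (fact i * fact (m - i)) = (fact m :: 'a)"
    using binomial_fact_lemma[OF \<open>i \<le> m\<close>] by (metis mult.commute of_nat_fact of_nat_mult)
  ultimately have ch: "fact m = of_nat (m - i) * (of_nat (m choose i) * (fact i * fact (m - 1 - i) :: 'a))"
    by (simp add: mult_ac)
  have "of_nat (m - i) \<noteq> (0 :: 'a)" using i by simp
  with fm ch have fm': "poly f (of_nat m) = of_nat (m choose i) * (fact i * fact (m - 1 - i))"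
    by (metis mult_left_cancel)
  have "(fact i * fact (m - 1 - i) :: 'a) * ((-1) ^ (m - 1 - i) * c i + of_nat (m choose i) * c m) = 0"
    using rel unfolding fi fm' by (simp add: algebra_simps)
  then have "(-1) ^ (m - 1 - i) * c i = - (of_nat (m choose i) * c m)"
    by (simp add: add_eq_0_iff2)
  \<comment> \<open>The sign is its own inverse; the remaining minus raises its exponent to
    \<open>m - i\<close>.\<close>
  then have "(-1) ^ (m - 1 - i) * ((-1) ^ (m - 1 - i) * c i) = (-1) ^ (m - 1 - i) * - (of_nat (m choose i) * c m)"
    by simp
  then show ?thesis
    by (simp add: mi mult.assoc[symmetric] power_mult_distrib[symmetric])
qed simp

section \<open>Bounds and limits for Pochhammer symbols and binomial coefficients\<close>

text \<open>The empty product is \<open>1\<close>; otherwise the first factor is \<open>a\<close>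
  and all later ones exceed \<open>1\<close>.\<close>

lemma min_one_le_pochhammer:
  fixes a :: real
  assumes "a > 0"
  shows "min a 1 \<le> pochhammer a l"
proof -
  have *: "a \<le> pochhammer a (Suc l)" for l
  proof (induction l)
    case (Suc l)
    have "pochhammer a (Suc l) * 1 \<le> pochhammer a (Suc l) * (a + of_nat (Suc l))"
      using assms by (intro mult_left_mono pochhammer_nonneg) auto
    also have "\<dots> = pochhammer a (Suc (Suc l))" by (rule pochhammer_Suc[symmetric])
    finally show ?case using Suc by simp
  qed simp
  show ?thesis
  proof (cases l)
    case (Suc l')
    then show ?thesis using *[of l'] by simp
  qed simp
qed

text \<open>For \<open>n > 0\<close> the quotient is a product of \<open>l\<close> factors
  \<open>1 - i / n\<close>, a fixed number, each tending to \<open>1\<close>.\<close>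

lemma tendsto_binomial_fact_div_power:
  "(\<lambda>n. real (n choose l) * fact l / real n ^ l) \<longlonglongrightarrow> 1"
proof -
  have "(\<lambda>n. \<Prod>i<l. 1 - real i / real n) \<longlonglongrightarrow> (\<Prod>i<l. 1 - 0)"
    by (intro tendsto_intros lim_const_over_n)
  moreover have "\<forall>\<^sub>F n in sequentially. (\<Prod>i<l. 1 - real i / real n) = real (n choose l) * fact l / real n ^ l"
  proof (rule eventually_mono[OF eventually_gt_at_top[of 0]])
    fix n :: nat assume n: "0 < n"
    have "real (n choose l) * fact l = (\<Prod>i<l. real n - real i)"
      by (simp add: binomial_gbinomial gbinomial_mult_fact' atLeast0LessThan)
    also have "\<dots> = (\<Prod>i<l. real n * (1 - real i / real n))"
      using n by (intro prod.cong) (auto simp: field_simps)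
    also have "\<dots> = real n ^ l * (\<Prod>i<l. 1 - real i / real n)"
      by (simp add: prod.distrib)
    finally show "(\<Prod>i<l. 1 - real i / real n) = real (n choose l) * fact l / real n ^ l"
      using n by simp
  qed
  ultimately show ?thesis by (simp add: tendsto_cong)
qed

text \<open>The numerator counts the injections among the \<open>n ^ l\<close> maps. For
  \<open>n = 0 < l\<close> division by zero gives \<open>0\<close>, so the bounds hold for every
  \<open>n\<close>.\<close>

lemma binomial_fact_div_power_bounds:
  "0 \<le> real (n choose l) * fact l / real n ^ l" "real (n choose l) * fact l / real n ^ l \<le> 1"
proof -
  have "(n choose l) * fact l \<le> n ^ l" by (rule binomial_fact_pow)
  then have "real ((n choose l) * fact l) \<le> real (n ^ l)" by (simp only: of_nat_le_iff)
  then show "real (n choose l) * fact l / real n ^ l \<le> 1"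
    by (auto simp: divide_le_eq_1)
qed simp

subsection \<open>The orthogonal polynomials and their limit\<close>

text \<open>These are the coefficients of the monic \<open>1F_r\<close> expression, because
  \<open>(-m)_l / l! = (-1) ^ l * (m choose l)\<close>.\<close>

lemma meijer_multiple_orthogonal_coeff:
  assumes r: "r \<ge> 1" and \<nu>: "\<And>k. k \<in> {1..r} \<Longrightarrow> \<nu> k > -1" and c: "\<And>k. k \<in> {1..r} \<Longrightarrow> c > - \<nu> k"
    and p: "meijer_multiple_orthogonal c r \<nu> m p" and "l \<le> m"
  shows "coeff p l = (-1) ^ (m - l) * of_nat (m choose l) *
    of_real (\<Prod>k=1..r. pochhammer (\<nu> k + 1) m / pochhammer (\<nu> k + 1) l)"
proof -
  have deg: "degree p = m" and lead: "coeff p m = 1" using p by (auto simp: meijer_multiple_orthogonal_def)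
  define W where "W l = (\<Prod>k=1..r. Gamma (real l + 1 + \<nu> k))" for l :: nat
  define C where "C l = coeff p l * of_real (W l)" for l
  define L where "L f = (\<Sum>l\<le>m. C l * poly f (of_nat l))" for f
  \<comment> \<open>\<open>W l\<close> times the value of \<open>q d\<close> at \<open>l\<close> is
    the moment of order \<open>l + d div r\<close> of the weight of index \<open>d mod r\<close>:
    the double product raises each Gamma argument by \<open>d div r\<close>, the single one is the
    Pochhammer symbol. There are \<open>d\<close> linear factors in all.\<close>
  define q :: "nat \<Rightarrow> complex poly" where
    "q d = (\<Prod>i<d mod r. [:of_real (real (d div r) + 1 + \<nu> 1 + real i), 1:]) *
       (\<Prod>k=1..r. \<Prod>i<d div r. [:of_real (1 + \<nu> k + real i), 1:])" for d
  have q_degree: "degree (q d) = d \<and> q d \<noteq> 0" for d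
  proof
    show "q d \<noteq> 0" by (auto simp: q_def)
    then show "degree (q d) = d"
      unfolding q_def
      by (subst degree_mult_eq) (auto simp: degree_prod_eq_sum_degree mult.commute)
  qed
  have q_eval: "of_real (W l) * poly (q d) (of_nat l) =
      of_real (pochhammer (real (l + d div r) + 1 + \<nu> 1) (d mod r) * W (l + d div r))" for l d
  proof -
    have "(\<Prod>i<d mod r. complex_of_real (real (d div r) + 1 + \<nu> 1 + real i) + of_nat l) =
        of_real (pochhammer (real (l + d div r) + 1 + \<nu> 1) (d mod r))"
      unfolding pochhammer_prod of_real_prod atLeast0LessThan by (intro prod.cong) auto
    moreover have "of_real (Gamma (real l + 1 + \<nu> k)) *
        (\<Prod>i<d div r. complex_of_real (1 + \<nu> k + real i) + of_nat l) =
        of_real (Gamma (real (l + d div r) + 1 + \<nu> k))" if "k \<in> {1..r}" for k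
    proof -
      have "(\<Prod>i<d div r. complex_of_real (1 + \<nu> k + real i) + of_nat l) =
          of_real (pochhammer (real l + 1 + \<nu> k) (d div r))"
        unfolding pochhammer_prod of_real_prod atLeast0LessThan by (intro prod.cong) auto
      moreover have "Gamma (real (l + d div r) + 1 + \<nu> k) =
          pochhammer (real l + 1 + \<nu> k) (d div r) * Gamma (real l + 1 + \<nu> k)"
        using Gamma_plus_of_nat[of "real l + 1 + \<nu> k" "d div r"] \<nu>[OF that] by (simp add: add_ac)
      ultimately show ?thesis by simp
    qed
    then have "of_real (W l) * (\<Prod>k=1..r. \<Prod>i<d div r. complex_of_real (1 + \<nu> k + real i) + of_nat l) =
        of_real (W (l + d div r))"
      unfolding W_def of_real_prod prod.distrib[symmetric] by (intro prod.cong refl)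
    ultimately show ?thesis
      by (simp add: q_def poly_prod mult_ac)
  qed
  have Lq: "L (smult a (q d)) = 0" if "d < m" for d a
  proof -
    let ?j = "d mod r" and ?k = "d div r"
    have "has_bochner_integral lborel
        (\<lambda>x. \<Sum>l\<le>m. coeff p l * (indicator {0<..} x *\<^sub>R (of_real x ^ (l + ?k) * meijer_weight c r \<nu> ?j x)))
        (\<Sum>l\<le>m. coeff p l * of_real (pochhammer (real (l + ?k) + 1 + \<nu> 1) ?j * W (l + ?k)))"
      unfolding W_def
      by (intro has_bochner_integral_sum has_bochner_integral_mult_right has_bochner_integral_meijer_weight r \<nu> c)
    moreover have "(\<Sum>l\<le>m. coeff p l * (indicator {0<..} x *\<^sub>R (of_real x ^ (l + ?k) * meijer_weight c r \<nu> ?j x))) =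
        indicator {0<..} x *\<^sub>R (poly p (of_real x) * of_real x ^ ?k * meijer_weight c r \<nu> ?j x)" for x
      unfolding poly_altdef deg
      by (simp add: sum_distrib_left sum_distrib_right scaleR_conv_of_real power_add mult_ac)
    moreover have "(\<Sum>l\<le>m. coeff p l * of_real (pochhammer (real (l + ?k) + 1 + \<nu> 1) ?j * W (l + ?k))) = L (q d)"
      unfolding L_def C_def q_eval[symmetric] by (simp add: mult.assoc)
    ultimately have "L (q d) = (LBINT x:{0<..}. poly p (of_real x) * of_real x ^ ?k * meijer_weight c r \<nu> ?j x)"
      by (simp add: has_bochner_integral_iff set_lebesgue_integral_def)
    also have "\<dots> = 0"
    proof -
      \<comment> \<open>With \<open>k = d div r\<close> and \<open>j = d mod r\<close>, the bound
        \<open>d < m\<close> says that \<open>k\<close> is strictly below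
        \<open>(m - j) / r\<close>, which for integers means at most the ceiling minus one.\<close>
      have "?k * r + ?j < m" using that by simp
      then have "real ?k * real r + real ?j < real m"
        by (simp only: of_nat_mult[symmetric] of_nat_add[symmetric] of_nat_less_iff)
      then have "real ?k < (real m - real ?j) / real r"
        using r by (simp add: pos_less_divide_eq)
      then have "int ?k \<le> \<lceil>(real m - real ?j) / real r\<rceil> - 1"
        using less_ceiling_iff[of "int ?k" "(real m - real ?j) / real r"] by simp
      moreover have "?j \<le> r - 1" using r mod_less_divisor[of r d] by linarith
      ultimately show ?thesis using p unfolding meijer_multiple_orthogonal_def by blast
    qed
    finally show ?thesis by (simp add: L_def sum_distrib_left[symmetric] mult.left_commute[of _ a])
  qed
  have Ldiff: "L (f - g) = L f - L g" for f g
    by (simp add: L_def right_diff_distrib sum_subtractf)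
  have L0: "L f = 0" if "degree f < m" for f
    by (rule annihilator_of_lower_degree[OF q_degree Ldiff Lq that])
  have "C l = (-1) ^ (m - l) * of_nat (m choose l) * C m"
    by (rule orthogonal_to_lower_degree_imp_binomial[OF L0[unfolded L_def] \<open>l \<le> m\<close>])
  \<comment> \<open>As the leading coefficient is \<open>1\<close>, \<open>C m = W m\<close>; this
    quotient is what accompanies the signed binomial coefficient.\<close>
  moreover have "W m / W l = (\<Prod>k=1..r. pochhammer (\<nu> k + 1) m / pochhammer (\<nu> k + 1) l)"
    unfolding W_def prod_dividef[symmetric]
  proof (rule prod.cong[OF refl])
    fix k assume "k \<in> {1..r}"
    then have pos: "\<nu> k + 1 > 0" using \<nu> by force
    then have "Gamma (\<nu> k + 1) \<noteq> 0" using Gamma_real_pos[OF pos] by linarith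
    then show "Gamma (real m + 1 + \<nu> k) / Gamma (real l + 1 + \<nu> k) =
        pochhammer (\<nu> k + 1) m / pochhammer (\<nu> k + 1) l"
      using Gamma_plus_of_nat[OF pos, of m] Gamma_plus_of_nat[OF pos, of l]
      by (simp add: add_ac)
  qed
  moreover have "W l > 0" unfolding W_def using \<nu> by (intro prod_pos) force
  ultimately show ?thesis
    by (simp add: C_def lead field_simps flip: of_real_divide)
qed

theorem theorem8:
  fixes r :: nat and \<nu> :: "nat \<Rightarrow> real" and c :: real
    and P :: "nat \<Rightarrow> complex poly" and K :: "complex set"
  assumes "r \<ge> 1"
    and "\<And>k. k \<in> {1..r} \<Longrightarrow> \<nu> k > -1"
    and "\<And>k. k \<in> {1..r} \<Longrightarrow> c > - \<nu> k"
    and "\<And>n. meijer_multiple_orthogonal c r \<nu> n (P n)"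
    and "compact K"
  shows "uniform_limit K
    (\<lambda>n z. (-1) ^ n * (poly (P n) (z / of_nat n) / (\<Prod>j=1..r. pochhammer (of_real (\<nu> j) + 1) n)))
    (\<lambda>z. hypergeo_0F r (\<lambda>j. of_real (\<nu> j) + 1) (- z)) sequentially"
proof -
  define w where "w l = (\<Prod>j=1..r. pochhammer (\<nu> j + 1) l)" for l
  \<comment> \<open>\<open>\<delta>\<close> bounds every \<open>w l\<close> from below, which
    compares the majorant \<open>M\<close> with an exponential series.\<close>
  define \<delta> where "\<delta> = (\<Prod>j=1..r. min (\<nu> j + 1) 1)"
  \<comment> \<open>\<open>t l n\<close> is the factor by which the \<open>l\<close>-th term of the
    rescaled polynomial differs from that of the limit series.\<close>
  define t where "t l n = real (n choose l) * fact l / real n ^ l" for l n :: nat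
  have \<nu>pos: "\<nu> j + 1 > 0" if "j \<in> {1..r}" for j using assms(2)[OF that] by simp
  have \<delta>pos: "\<delta> > 0" unfolding \<delta>_def using \<nu>pos by (intro prod_pos) auto
  have w_ge: "\<delta> \<le> w l" for l
    unfolding \<delta>_def w_def using \<nu>pos by (intro prod_mono) (force intro: min_one_le_pochhammer)
  have w_pos: "w l > 0" for l using \<delta>pos w_ge[of l] by linarith
  have w_complex: "(\<Prod>j=1..r. pochhammer (complex_of_real (\<nu> j) + 1) l) = of_real (w l)" for l
    unfolding w_def of_real_prod
    by (intro prod.cong refl) (metis of_real_1 of_real_add pochhammer_of_real)
  obtain R where R: "R > 0" "\<And>z. z \<in> K \<Longrightarrow> norm z \<le> R"
    using compact_imp_bounded[OF assms(5)] by (auto simp: bounded_pos)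
  have t01: "0 \<le> t l n" "t l n \<le> 1" for l n
    unfolding t_def by (rule binomial_fact_div_power_bounds)+
  define M where "M l = R ^ l / (w l * fact l)" for l
  have M_nonneg: "M l \<ge> 0" for l using R w_pos[of l] by (simp add: M_def)
  have "summable (\<lambda>l. (1 / \<delta>) * (R ^ l /\<^sub>R fact l))"
    by (intro summable_mult summable_exp_generic)
  then have M_summable: "summable M"
  proof (rule summable_comparison_test'[where N = 0])
    fix l
    have "R ^ l / (w l * fact l) \<le> R ^ l / (\<delta> * fact l)"
      using \<delta>pos w_ge[of l] R by (intro divide_left_mono mult_right_mono mult_pos_pos w_pos) auto
    moreover have "norm (M l) = R ^ l / (w l * fact l)"
      using M_nonneg[of l] by (simp only: real_norm_def abs_of_nonneg) (simp only: M_def)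
    ultimately show "norm (M l) \<le> (1 / \<delta>) * (R ^ l /\<^sub>R fact l)"
      by (simp add: divide_inverse mult_ac)
  qed
  \<comment> \<open>Since \<open>t l n\<close> lies between \<open>0\<close> and \<open>1\<close>,
    so does its distance from \<open>1\<close>, and \<open>M\<close> itself majorizes the
    errors.\<close>
  have aM: "\<bar>t l n - 1\<bar> * M l \<le> M l" for l n
    using mult_right_mono[of "\<bar>t l n - 1\<bar>" 1 "M l"] t01[of l n] M_nonneg[of l] by simp
  have lim: "(\<lambda>n. \<Sum>l. \<bar>t l n - 1\<bar> * M l) \<longlonglongrightarrow> (\<Sum>l. 0)"
  proof (rule tannerys_theorem[where M = M, THEN conjunct2, THEN conjunct2])
    fix l
    have "(\<lambda>n. \<bar>t l n - 1\<bar> * M l) \<longlonglongrightarrow> \<bar>1 - 1\<bar> * M l"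
      unfolding t_def by (intro tendsto_intros tendsto_binomial_fact_div_power)
    then show "(\<lambda>n. \<bar>t l n - 1\<bar> * M l) \<longlonglongrightarrow> 0" by simp
    show "\<forall>\<^sub>F (l, n) in sequentially \<times>\<^sub>F sequentially. norm (\<bar>t l n - 1\<bar> * M l) \<le> M l"
      using aM M_nonneg by (intro always_eventually) (auto simp: abs_mult)
  qed (auto simp: M_summable)
  have bound: "dist ((-1) ^ n * (poly (P n) (z / of_nat n) / (\<Prod>j=1..r. pochhammer (of_real (\<nu> j) + 1) n)))
      (hypergeo_0F r (\<lambda>j. of_real (\<nu> j) + 1) (- z)) \<le> (\<Sum>l. \<bar>t l n - 1\<bar> * M l)" if z: "z \<in> K" for n z
  proof -
    let ?a = "\<lambda>l. (- z) ^ l / (of_real (w l) * fact l)"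
    have a_le: "norm (?a l) \<le> M l" for l
      using R(2)[OF z] w_pos[of l] by (simp add: M_def norm_divide norm_mult norm_power divide_right_mono power_mono)
    have a_summable: "summable ?a"
      by (rule summable_comparison_test'[OF M_summable a_le])
    have ta_summable: "summable (\<lambda>l. of_real (t l n) * ?a l)"
    proof (rule summable_comparison_test'[OF M_summable, where N = 0])
      fix l
      show "norm (of_real (t l n) * ?a l) \<le> M l"
        using mult_mono[OF t01(2)[of l n] a_le[of l]]
        by (simp only: norm_mult norm_of_real abs_of_nonneg[OF t01(1)]) simp
    qed
    have "(-1) ^ n * (poly (P n) (z / of_nat n) / of_real (w n)) = (\<Sum>l\<le>n. of_real (t l n) * ?a l)"
    proof -
      have "degree (P n) = n" using assms(4) by (simp add: meijer_multiple_orthogonal_def)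
      then have "(-1) ^ n * (poly (P n) (z / of_nat n) / of_real (w n)) =
          (\<Sum>l\<le>n. (-1) ^ n * (coeff (P n) l * (z / of_nat n) ^ l / of_real (w n)))"
        by (simp add: poly_altdef sum_divide_distrib sum_distrib_left)
      also have "\<dots> = (\<Sum>l\<le>n. of_real (t l n) * ?a l)"
      proof (rule sum.cong[OF refl])
        fix l assume "l \<in> {..n}"
        then have l: "l \<le> n" by simp
        have coeff: "coeff (P n) l = (-1) ^ (n - l) * of_nat (n choose l) * (of_real (w n) / of_real (w l))"
          using meijer_multiple_orthogonal_coeff[OF assms(1-4) l] by (simp add: w_def prod_dividef)
        \<comment> \<open>The surviving \<open>(-1) ^ l\<close> passes into
          \<open>(- z) ^ l\<close>, the argument of the limit.\<close>
        have sign: "(-1) ^ n * (-1) ^ (n - l) = ((-1) ^ l :: complex)"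
          using l by (metis even_add even_diff_nat le_add_diff_inverse minus_one_power_iff power_add)
        have "(-1) ^ n * (coeff (P n) l * (z / of_nat n) ^ l / of_real (w n)) =
            ((-1) ^ n * (-1) ^ (n - l)) * (of_nat (n choose l) * (z / of_nat n) ^ l / of_real (w l))"
          unfolding coeff using w_pos[of n] by simp
        also have "\<dots> = of_real (t l n) * ?a l"
          unfolding sign by (simp add: t_def power_divide power_minus[of z] mult_ac)
        finally show "(-1) ^ n * (coeff (P n) l * (z / of_nat n) ^ l / of_real (w n)) = of_real (t l n) * ?a l" .
      qed
      finally show ?thesis .
    qed
    \<comment> \<open>The binomial coefficient in \<open>t l n\<close> vanishes for
      \<open>l > n\<close>, so the polynomial is a full series and can be compared with the limit
      term by term.\<close>
    also have "\<dots> = (\<Sum>l. of_real (t l n) * ?a l)"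
      by (rule suminf_finite[symmetric]) (auto simp: t_def)
    finally have "(-1) ^ n * (poly (P n) (z / of_nat n) / of_real (w n)) - (\<Sum>l. ?a l) =
        (\<Sum>l. of_real (t l n) * ?a l - ?a l)"
      using suminf_diff[OF ta_summable a_summable] by simp
    also have "norm \<dots> \<le> (\<Sum>l. \<bar>t l n - 1\<bar> * M l)"
    proof (rule norm_suminf_le)
      fix l
      have "of_real (t l n) * ?a l - ?a l = of_real (t l n - 1) * ?a l" by (simp only: of_real_diff of_real_1 left_diff_distrib mult_1_left)
      then show "norm (of_real (t l n) * ?a l - ?a l) \<le> \<bar>t l n - 1\<bar> * M l"
        using mult_left_mono[OF a_le, of "\<bar>t l n - 1\<bar>" l] by (simp only: norm_mult norm_of_real abs_ge_zero)
    next
      show "summable (\<lambda>l. \<bar>t l n - 1\<bar> * M l)"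
        by (rule summable_comparison_test'[OF M_summable, where N = 0])
          (use aM M_nonneg in \<open>auto simp: abs_mult\<close>)
    qed
    finally show ?thesis
      by (simp only: dist_norm hypergeo_0F_def w_complex)
  qed
  show ?thesis
  proof (rule uniform_limitI)
    fix e :: real assume "e > 0"
    then have "\<forall>\<^sub>F n in sequentially. (\<Sum>l. \<bar>t l n - 1\<bar> * M l) < e"
      using lim by (intro order_tendstoD(2)[of _ 0]) auto
    then show "\<forall>\<^sub>F n in sequentially. \<forall>z\<in>K.
        dist ((-1) ^ n * (poly (P n) (z / of_nat n) / (\<Prod>j=1..r. pochhammer (of_real (\<nu> j) + 1) n)))
          (hypergeo_0F r (\<lambda>j. of_real (\<nu> j) + 1) (- z)) < e"
      by (rule eventually_mono) (blast intro: le_less_trans[OF bound])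
  qed
qed

end
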